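(* Let $m$ and $n$ be positive integers and let $\tau_o(K_{m,n})$ denote the number of odd spanning trees of the complete bipartite graph $K_{m,n}$. Then $$\tau_o(K_{m,n})=\frac{1}{2^{m+n}}\left[\sum_{i=0}^{m}\binom{m}{i}(2i-m)^{n-1}\right]\left[\sum_{j=0}^{n}\binom{n}{j}(2j-n)^{m-1}\right].$$
   Context: $K_{m,n}$ is the complete bipartite graph whose two parts have $m$ and $n$ labelled vertices. An odd spanning tree of a graph $G$ is a spanning tree $T$ of $G$ in which every vertex has odd degree in $T$; spanning trees are counted as subgraphs of the labelled graph. The convention $0^0=1$ is used. *)

theory Defs
  imports Complex_Main "Graph_Theory.Graph_Theory"
begin

text \<open>
  As in Graph_Theory, a finite simple graph is a symmetric digraph without loops or parallel
  arcs (locale \<^locale>\<open>graph\<close>): the edge uv is the pair of opposite arcs (u,v) and (v,u).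
  The constants \<^const>\<open>forest\<close>, \<^const>\<open>tree\<close> and \<^const>\<open>spanning_tree\<close> of that library
  forbid directed cycles, among them the closed walk u, v, u, so no graph with an edge
  is a tree in that sense. In a simple graph the cycles are exactly the closed walks with
  distinct vertices that have length at least 3.
\<close>

definition graph_cycle :: "('a, 'b) pre_digraph \<Rightarrow> 'b awalk \<Rightarrow> bool" where
  "graph_cycle G p \<longleftrightarrow> pre_digraph.cycle G p \<and> 3 \<le> length p"

definition graph_tree :: "('a, 'b) pre_digraph \<Rightarrow> bool" where
  "graph_tree T \<longleftrightarrow> graph T \<and> connected T \<and> \<not> (\<exists>p. graph_cycle T p)"

definition graph_spanning_tree :: "('a, 'b) pre_digraph \<Rightarrow> ('a, 'b) pre_digraph \<Rightarrow> bool" where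
  "graph_spanning_tree T G \<longleftrightarrow> graph_tree T \<and> spanning T G"

text \<open>
  In a symmetric digraph without parallel arcs, each edge at v contributes exactly one arc leaving v,
  so \<^const>\<open>out_degree\<close> is the degree in the graph.
\<close>

definition odd_spanning_tree :: "('a, 'b) pre_digraph \<Rightarrow> ('a, 'b) pre_digraph \<Rightarrow> bool" where
  "odd_spanning_tree T G \<longleftrightarrow>
     graph_spanning_tree T G \<and> (\<forall>v \<in> verts T. odd (out_degree T v))"

text \<open>
  A subgraph shares the functions \<^const>\<open>tail\<close> and \<^const>\<open>head\<close> with G, hence is determined by its
  vertices and arcs; the cardinality below counts labelled subgraphs, not isomorphism classes.
\<close>

definition tau_o :: "('a, 'b) pre_digraph \<Rightarrow> nat" where
  "tau_o G = card {T. odd_spanning_tree T G}"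

end

theory Submission
  imports Defs
begin

text \<open>
  For fixed degrees $d$ on $U$ and $e$ on $V$, the spanning trees of the complete bipartite graph on
  $U$ and $V$ are equinumerous with the pairs of words $(x, y)$, $x$ of length $|V| - 1$ over $U$ and
  $y$ of length $|U| - 1$ over $V$, in which each vertex occurs one time less than its degree.
  Removing a leaf $u \in U$ attached to $v$ lowers $e(v)$ by one, which is what removing the first
  letter $v$ does to $y$, while $u$ does not occur in $x$. Hence odd trees correspond to
  pairs of words in which every letter occurs an even number of times. Such words of length $k$ are
  counted by averaging $(\sum_{u \in U} s_u)^k$ over all sign vectors $s \in \{-1, 1\}^U$.
\<close>

subsection \<open>Bipartite trees and their degrees\<close>

text \<open>Edges are stored as pairs directed from the left class to the right class, and a tree
  grows from one edge by attaching leaves. Both classes are therefore nonempty. Disjointness of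
  \<open>U\<close> and \<open>V\<close> is not built in and becomes a separate hypothesis where both
  sets lie in one graph.\<close>

inductive btree :: "'a set \<Rightarrow> 'b set \<Rightarrow> ('a \<times> 'b) set \<Rightarrow> bool" where
  edge: "btree {u} {v} {(u, v)}"
| leaf_left: "btree U V E \<Longrightarrow> u \<notin> U \<Longrightarrow> v \<in> V \<Longrightarrow> btree (insert u U) V (insert (u, v) E)"
| leaf_right: "btree U V E \<Longrightarrow> u \<in> U \<Longrightarrow> v \<notin> V \<Longrightarrow> btree U (insert v V) (insert (u, v) E)"

lemma btree_finite: "btree U V E \<Longrightarrow> finite U \<and> finite V"
  by (induction rule: btree.induct) auto

lemma btree_subset: "btree U V E \<Longrightarrow> E \<subseteq> U \<times> V"
  by (induction rule: btree.induct) auto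

lemma btree_Domain: "btree U V E \<Longrightarrow> Domain E = U"
  by (induction rule: btree.induct) auto

lemma btree_Range: "btree U V E \<Longrightarrow> Range E = V"
  by (induction rule: btree.induct) auto

lemma btree_finite_edges: "btree U V E \<Longrightarrow> finite E"
  by (induction rule: btree.induct) auto

lemma btree_card: "btree U V E \<Longrightarrow> Suc (card E) = card U + card V"
proof (induction rule: btree.induct)
  case (leaf_left U V E u v)
  then have "(u, v) \<notin> E" using btree_subset by fastforce
  with leaf_left show ?case using btree_finite[of U V E] btree_finite_edges[of U V E] by simp
next
  case (leaf_right U V E u v)
  then have "(u, v) \<notin> E" using btree_subset by fastforce
  with leaf_right show ?case using btree_finite[of U V E] btree_finite_edges[of U V E] by simp
qed simp

lemma btree_converse: "btree U V E \<Longrightarrow> btree V U (E\<inverse>)"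
proof (induction rule: btree.induct)
  case (edge u v)
  have "{(u, v)}\<inverse> = {(v, u)}" by auto
  then show ?case by (simp add: btree.edge)
next
  case (leaf_left U V E u v)
  have "(insert (u, v) E)\<inverse> = insert (v, u) (E\<inverse>)" by auto
  with leaf_left show ?case by (simp add: btree.leaf_right)
next
  case (leaf_right U V E u v)
  have "(insert (u, v) E)\<inverse> = insert (v, u) (E\<inverse>)" by auto
  with leaf_right show ?case by (simp add: btree.leaf_left)
qed

text \<open>The inductive rules remove only the leaf attached last. Any other left leaf can be
  removed as well: take it off the smaller tree first and then attach the last leaf again. The third
  assumption excludes the single edge, whose remainder would have an empty class.\<close>

lemma btree_remove_leaf:
  assumes "btree U V E" and "E `` {u0} = {v0}" and "U \<noteq> {u0}"
  shows "btree (U - {u0}) V (E - {(u0, v0)})"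
  using assms
proof (induction rule: btree.induct)
  case (edge u v)
  then show ?case by auto
next
  case (leaf_left U V E u v)
  note sub = btree_subset[OF leaf_left.hyps(1)]
  show ?case
  proof (cases "u0 = u")
    case True
    then have "v0 = v" using leaf_left.prems by auto
    moreover have "(u, v) \<notin> E" using sub leaf_left.hyps by auto
    ultimately show ?thesis using True leaf_left.hyps by simp
  next
    case False
    then have img: "E `` {u0} = {v0}" using leaf_left.prems by auto
    show ?thesis
    proof (cases "U = {u0}")
      case True
      \<comment> \<open>Here the smaller tree is the single edge at \<open>u0\<close>, so the
        induction hypothesis does not apply. What remains is the newly attached edge alone.\<close>
      have E: "E = {(u0, v0)}" using True sub img by auto
      then have "V = {v0}" using btree_Range[OF leaf_left.hyps(1)] by auto
      then have "insert u U - {u0} = {u}" "V = {v}" "insert (u, v) E - {(u0, v0)} = {(u, v)}"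
        using True False E leaf_left.hyps by auto
      then show ?thesis by (simp add: btree.edge)
    next
      case False
      from leaf_left.IH[OF img this]
      have "btree (insert u (U - {u0})) V (insert (u, v) (E - {(u0, v0)}))"
        using leaf_left.hyps by (intro btree.leaf_left) auto
      then show ?thesis using \<open>u0 \<noteq> u\<close> by (simp add: insert_Diff_if)
    qed
  qed
next
  case (leaf_right U V E u v)
  note sub = btree_subset[OF leaf_right.hyps(1)]
  \<comment> \<open>A new right leaf attached to \<open>u0\<close> would give \<open>u0\<close> a
    second neighbour besides the one it already has in \<open>E\<close>.\<close>
  have "u \<noteq> u0"
  proof
    assume "u = u0"
    obtain w where "(u, w) \<in> E" "w \<in> V"
      using btree_Domain[OF leaf_right.hyps(1)] sub leaf_right.hyps(2) by blast
    then have "{v, w} \<subseteq> insert (u, v) E `` {u0}" using \<open>u = u0\<close> by auto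
    then show False using leaf_right.prems leaf_right.hyps \<open>w \<in> V\<close> by auto
  qed
  then have img: "E `` {u0} = {v0}" using leaf_right.prems by auto
  have "btree (U - {u0}) (insert v V) (insert (u, v) (E - {(u0, v0)}))"
    using leaf_right.IH[OF img leaf_right.prems(2)] leaf_right.hyps \<open>u \<noteq> u0\<close>
    by (intro btree.leaf_right) auto
  then show ?case using \<open>u \<noteq> u0\<close> by (simp add: insert_Diff_if)
qed

lemma btree_single: "btree {u} {v} E \<longleftrightarrow> E = {(u, v)}"
proof
  assume b: "btree {u} {v} E"
  have "E \<subseteq> {(u, v)}" using btree_subset[OF b] by simp
  moreover have "E \<noteq> {}" using btree_Domain[OF b] by auto
  ultimately show "E = {(u, v)}" by auto
qed (simp add: btree.edge)

section \<open>Recursions for trees and words with prescribed degrees\<close>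

definition trees_deg :: "'a set \<Rightarrow> 'b set \<Rightarrow> ('a \<Rightarrow> nat) \<Rightarrow> ('b \<Rightarrow> nat) \<Rightarrow> ('a \<times> 'b) set set" where
  "trees_deg U V d e = {E. btree U V E \<and> (\<forall>u\<in>U. card (E `` {u}) = d u) \<and> (\<forall>v\<in>V. card (E\<inverse> `` {v}) = e v)}"

definition words_deg :: "nat \<Rightarrow> 'a set \<Rightarrow> ('a \<Rightarrow> nat) \<Rightarrow> 'a list set" where
  "words_deg n U d = {xs. length xs = n \<and> set xs \<subseteq> U \<and> (\<forall>u\<in>U. Suc (count_list xs u) = d u)}"

lemma finite_trees_deg: "finite U \<Longrightarrow> finite V \<Longrightarrow> finite (trees_deg U V d e)"
  by (rule finite_subset[of _ "Pow (U \<times> V)"]) (auto simp: trees_deg_def dest: btree_subset)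

lemma finite_words_deg: "finite U \<Longrightarrow> finite (words_deg n U d)"
  by (rule finite_subset[OF _ finite_lists_length_eq[of U n]]) (auto simp: words_deg_def)

lemma card_trees_deg_swap: "card (trees_deg U V d e) = card (trees_deg V U e d)"
proof -
  have "trees_deg V U e d = converse ` trees_deg U V d e"
  proof (intro set_eqI iffI)
    fix E assume "E \<in> trees_deg V U e d"
    then have "E\<inverse> \<in> trees_deg U V d e" by (auto simp: trees_deg_def btree_converse)
    then show "E \<in> converse ` trees_deg U V d e" by (rule rev_image_eqI) simp
  qed (auto simp: trees_deg_def btree_converse)
  then show ?thesis by (simp add: card_image inj_on_def)
qed

text \<open>Words are split by their first letter. If \<open>d u\<close> is at most 1, the updated
  degree is 0, no word attains it, and the summand vanishes, as it must because \<open>u\<close>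
  cannot be the first letter.\<close>

lemma card_words_deg_Suc:
  assumes "finite U"
  shows "card (words_deg (Suc n) U d) = (\<Sum>u\<in>U. card (words_deg n U (d(u := d u - 1))))"
proof -
  have "words_deg (Suc n) U d = (\<Union>u\<in>U. (#) u ` words_deg n U (d(u := d u - 1)))"
  proof (intro set_eqI iffI)
    fix xs assume xs: "xs \<in> words_deg (Suc n) U d"
    then obtain u ys where [simp]: "xs = u # ys" by (cases xs) (auto simp: words_deg_def)
    have "u \<in> U" using xs by (auto simp: words_deg_def)
    moreover have "ys \<in> words_deg n U (d(u := d u - 1))"
      using xs by (auto simp: words_deg_def split: if_splits)
    ultimately show "xs \<in> (\<Union>u\<in>U. (#) u ` words_deg n U (d(u := d u - 1)))" by auto
  next
    fix xs assume "xs \<in> (\<Union>u\<in>U. (#) u ` words_deg n U (d(u := d u - 1)))"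
    then obtain u ys where u: "u \<in> U" and ys: "ys \<in> words_deg n U (d(u := d u - 1))" and "xs = u # ys"
      by auto
    \<comment> \<open>The left side is positive, which forces \<open>d u\<close> to be at least 2,
      so the subtraction is not truncated.\<close>
    have "Suc (count_list ys u) = d u - 1" using u ys by (auto simp: words_deg_def)
    then have "Suc (Suc (count_list ys u)) = d u" by simp
    with u ys show "xs \<in> words_deg (Suc n) U d"
      by (auto simp: words_deg_def \<open>xs = u # ys\<close> split: if_splits)
  qed
  also have "card \<dots> = (\<Sum>u\<in>U. card ((#) u ` words_deg n U (d(u := d u - 1))))"
    using assms by (intro card_UN_disjoint) (auto simp: finite_words_deg)
  finally show ?thesis by (simp add: card_image del: fun_upd_apply)
qed

lemma words_deg_insert:
  assumes "u \<notin> U" "d u = 1"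
  shows "words_deg n (insert u U) d = words_deg n U d"
  using assms by (force simp: words_deg_def count_list_0_iff)

text \<open>The leaf \<open>u0\<close> has exactly one neighbour \<open>v\<close>, and deleting it
  lowers only the degree of \<open>v\<close>. Summing over \<open>v\<close> gives the counterpart
  for trees of \<open>card_words_deg_Suc\<close> on the \<open>V\<close> side.\<close>

lemma card_trees_deg_insert:
  assumes "finite U" "finite V" "U \<noteq> {}" "u0 \<notin> U" "d u0 = 1"
  shows "card (trees_deg (insert u0 U) V d e) = (\<Sum>v\<in>V. card (trees_deg U V d (e(v := e v - 1))))"
proof -
  have img: "insert (u0, v) E `` {u0} = {v}" "(u0, v) \<notin> E"
      "\<And>u. u \<in> U \<Longrightarrow> insert (u0, v) E `` {u} = E `` {u}"
      "(insert (u0, v) E)\<inverse> `` {v} = insert u0 (E\<inverse> `` {v})" "u0 \<notin> E\<inverse> `` {v}"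
      "\<And>w. w \<noteq> v \<Longrightarrow> (insert (u0, v) E)\<inverse> `` {w} = E\<inverse> `` {w}"
      "\<And>w. finite (E\<inverse> `` {w})"
    if "btree U V E" "v \<in> V" for E v
  proof -
    show "finite (E\<inverse> `` {w})" for w using btree_finite_edges[OF that(1)] by (simp add: finite_Image)
  qed (use btree_subset[OF that(1)] that(2) assms(4) in auto)
  \<comment> \<open>Every vertex of the smaller tree still has positive degree, so
    \<open>e v - 1\<close> is not truncated when the leaf is put back.\<close>
  have pos: "card (E\<inverse> `` {v}) > 0" if "btree U V E" "v \<in> V" for E v
    using btree_Range[OF that(1)] that img(7)[OF that] by (auto simp: card_gt_0_iff)
  have "trees_deg (insert u0 U) V d e = (\<Union>v\<in>V. insert (u0, v) ` trees_deg U V d (e(v := e v - 1)))"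
  proof (intro set_eqI iffI)
    fix E assume E: "E \<in> trees_deg (insert u0 U) V d e"
    then have "card (E `` {u0}) = 1" using assms by (simp add: trees_deg_def)
    then obtain v where v: "E `` {u0} = {v}" by (auto simp: card_Suc_eq)
    define F where "F = E - {(u0, v)}"
    have bE: "btree (insert u0 U) V E" using E by (simp add: trees_deg_def)
    have "v \<in> V" using v btree_subset[OF bE] by auto
    have E_eq: "E = insert (u0, v) F" using v by (auto simp: F_def)
    have bF: "btree U V F"
      using btree_remove_leaf[OF bE v] assms unfolding F_def by (auto simp: insert_Diff_if)
    have "F \<in> trees_deg U V d (e(v := e v - 1))"
      unfolding trees_deg_def
    proof (safe intro!: bF)
      fix u assume "u \<in> U"
      then have "card (E `` {u}) = d u" using E by (simp add: trees_deg_def)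
      then show "card (F `` {u}) = d u" using img(3)[OF bF \<open>v \<in> V\<close> \<open>u \<in> U\<close>] E_eq by simp
    next
      fix w assume "w \<in> V"
      then have "card (E\<inverse> `` {w}) = e w" using E by (simp add: trees_deg_def)
      then show "card (F\<inverse> `` {w}) = (e(v := e v - 1)) w"
        using img(4-7)[OF bF \<open>v \<in> V\<close>] E_eq by (cases "w = v") auto
    qed
    then show "E \<in> (\<Union>v\<in>V. insert (u0, v) ` trees_deg U V d (e(v := e v - 1)))"
      using \<open>v \<in> V\<close> E_eq by blast
  next
    fix E assume "E \<in> (\<Union>v\<in>V. insert (u0, v) ` trees_deg U V d (e(v := e v - 1)))"
    then obtain v F where "v \<in> V" and F: "F \<in> trees_deg U V d (e(v := e v - 1))"
      and E_eq: "E = insert (u0, v) F" by auto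
    have bF: "btree U V F" using F by (simp add: trees_deg_def)
    show "E \<in> trees_deg (insert u0 U) V d e"
      unfolding trees_deg_def
    proof (intro CollectI conjI ballI)
      show "btree (insert u0 U) V E"
        unfolding E_eq using bF \<open>v \<in> V\<close> assms by (intro btree.leaf_left)
      fix u assume "u \<in> insert u0 U"
      then show "card (E `` {u}) = d u"
        using img(1,3)[OF bF \<open>v \<in> V\<close>] F assms(5) by (auto simp: E_eq trees_deg_def)
    next
      fix w assume "w \<in> V"
      then have "card (F\<inverse> `` {w}) = (e(v := e v - 1)) w" using F by (simp add: trees_deg_def)
      then show "card (E\<inverse> `` {w}) = e w"
        using img(4-7)[OF bF \<open>v \<in> V\<close>] pos[OF bF \<open>w \<in> V\<close>] E_eq by (cases "w = v") auto
    qed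
  qed
  also have "card \<dots> = (\<Sum>v\<in>V. card (insert (u0, v) ` trees_deg U V d (e(v := e v - 1))))"
  proof (intro card_UN_disjoint ballI impI)
    fix v w assume "v \<in> V" "w \<in> V" "v \<noteq> w"
    \<comment> \<open>The pieces are disjoint because \<open>v\<close> can be recovered from
      \<open>E\<close> as the only neighbour of \<open>u0\<close>.\<close>
    have False if E_v: "E \<in> insert (u0, v) ` trees_deg U V d (e(v := e v - 1))"
      and E_w: "E \<in> insert (u0, w) ` trees_deg U V d (e(w := e w - 1))" for E
    proof -
      obtain F where F: "btree U V F" "E = insert (u0, v) F"
        using E_v by (auto simp: trees_deg_def)
      obtain F' where F': "btree U V F'" "E = insert (u0, w) F'"
        using E_w by (auto simp: trees_deg_def)
      from F F' have "E `` {u0} = {v}" "E `` {u0} = {w}" using img(1) \<open>v \<in> V\<close> \<open>w \<in> V\<close> by metis+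
      with \<open>v \<noteq> w\<close> show False by simp
    qed
    then show "insert (u0, v) ` trees_deg U V d (e(v := e v - 1)) \<inter>
        insert (u0, w) ` trees_deg U V d (e(w := e w - 1)) = {}" by blast
  qed (use assms in \<open>auto intro: finite_trees_deg\<close>)
  also have "\<dots> = (\<Sum>v\<in>V. card (trees_deg U V d (e(v := e v - 1))))"
  proof (intro sum.cong refl card_image inj_onI)
    fix v E F assume "v \<in> V" "E \<in> trees_deg U V d (e(v := e v - 1))"
      "F \<in> trees_deg U V d (e(v := e v - 1))" "insert (u0, v) E = insert (u0, v) F"
    then show "E = F" using img(2)[of E v] img(2)[of F v] unfolding trees_deg_def by auto
  qed
  finally show ?thesis .
qed

lemma sum_card_Image:
  assumes "finite U" "finite E" "E \<subseteq> U \<times> V"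
  shows "(\<Sum>u\<in>U. card (E `` {u})) = card E"
proof -
  have "E = (SIGMA u:U. E `` {u})" using assms by auto
  moreover have "card (SIGMA u:U. E `` {u}) = (\<Sum>u\<in>U. card (E `` {u}))"
    using assms by (intro card_SigmaI) (auto simp: finite_Image)
  ultimately show ?thesis by simp
qed

text \<open>An average below 2 forces a value 1 among positive integers. This is applied to the
  degrees of a tree and to the degrees prescribed by a word.\<close>

lemma ex_eq_1_of_sum:
  fixes d :: "'a \<Rightarrow> nat"
  assumes "\<And>u. u \<in> U \<Longrightarrow> 0 < d u" "sum d U < 2 * card U"
  shows "\<exists>u\<in>U. d u = 1"
proof (rule ccontr)
  assume "\<not> ?thesis"
  then have "2 \<le> d u" if "u \<in> U" for u using assms(1)[OF that] that by (metis One_nat_def Suc_leI le_neq_implies_less numeral_2_eq_2)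
  then have "(\<Sum>u\<in>U. 2) \<le> sum d U" by (intro sum_mono)
  with assms(2) show False by simp
qed

text \<open>The larger side of a bipartite tree contains a leaf, and the degrees determine which.\<close>

lemma card_trees_deg:
  fixes U V :: "'a set"
  assumes "finite U" "finite V" "U \<noteq> {}" "V \<noteq> {}"
  shows "card (trees_deg U V d e) =
    card (words_deg (card V - 1) U d) * card (words_deg (card U - 1) V e)"
  using assms
proof (induction "card U + card V" arbitrary: U V d e rule: less_induct)
  case less
  \<comment> \<open>The induction hypothesis is made a premise of \<open>main\<close>, so that
    \<open>main\<close> can also be instantiated with the two classes exchanged.\<close>
  have main: "card (trees_deg U V d e) =
      card (words_deg (card V - 1) U d) * card (words_deg (card U - 1) V e)"
    if fin: "finite U" "finite V" "U \<noteq> {}" "V \<noteq> {}" and le: "card V \<le> card U"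
      and IH: "\<And>(U' :: 'a set) (V' :: 'a set) d e. card U' + card V' < card U + card V \<Longrightarrow> finite U' \<Longrightarrow> finite V' \<Longrightarrow>
        U' \<noteq> {} \<Longrightarrow> V' \<noteq> {} \<Longrightarrow> card (trees_deg U' V' d e) =
          card (words_deg (card V' - 1) U' d) * card (words_deg (card U' - 1) V' e)"
    for U V :: "'a set" and d e
  proof (cases "card U = 1")
    case True
    then have "card V = 1" using le fin by (metis One_nat_def Suc_leI card_gt_0_iff le_antisym)
    with True obtain u v where UV: "U = {u}" "V = {v}" by (auto simp: card_Suc_eq)
    have "trees_deg {u} {v} d e = (if d u = 1 \<and> e v = 1 then {{(u, v)}} else {})"
    proof -
      have "{(u, v)} `` {u} = {v}" "{(u, v)}\<inverse> `` {v} = {u}" by auto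
      then show ?thesis by (auto simp: trees_deg_def btree_single)
    qed
    moreover have "words_deg 0 {w} d = (if d w = 1 then {[]} else {})" for d and w :: 'a
      by (auto simp: words_deg_def)
    ultimately show ?thesis by (simp add: UV)
  next
    case False
    then have "card U \<ge> 2" using fin by (metis One_nat_def Suc_leI card_gt_0_iff le_neq_implies_less numeral_2_eq_2)
    show ?thesis
    proof (cases "\<exists>u\<in>U. d u = 1")
      case True
      then obtain u0 where u0: "u0 \<in> U" "d u0 = 1" by blast
      define U' where "U' = U - {u0}"
      have U: "U = insert u0 U'" "u0 \<notin> U'" "finite U'" using u0 fin by (auto simp: U'_def)
      then have c: "card U = Suc (card U')" by simp
      then obtain k where k: "card U' = Suc k" using \<open>card U \<ge> 2\<close> by (cases "card U'") auto
      then have "U' \<noteq> {}" by auto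
      have "card (trees_deg U V d e) = (\<Sum>v\<in>V. card (trees_deg U' V d (e(v := e v - 1))))"
        unfolding U(1) using U fin u0 \<open>U' \<noteq> {}\<close> by (intro card_trees_deg_insert)
      \<comment> \<open>Since \<open>card U' = Suc k\<close>, the words over \<open>V\<close> now
        have length \<open>k\<close>, one less than before, while the words over the left class keep
        their length.\<close>
      also have "\<dots> = (\<Sum>v\<in>V. card (words_deg (card V - 1) U' d) * card (words_deg k V (e(v := e v - 1))))"
        using IH[of U' V] fin U \<open>U' \<noteq> {}\<close> c k by (intro sum.cong) auto
      also have "\<dots> = card (words_deg (card V - 1) U' d) * card (words_deg (Suc k) V e)"
        using fin by (simp add: card_words_deg_Suc sum_distrib_left)
      finally show ?thesis using c k words_deg_insert[of u0 U' d] U u0 by simp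
    next
      case False
      \<comment> \<open>Without a degree 1 in \<open>U\<close> both sides of the equation vanish. In
        a tree the positive degrees on \<open>U\<close> sum to \<open>card U + card V - 1\<close>,
        which is below \<open>2 * card U\<close>; a word over \<open>U\<close> forces the same
        sum.\<close>
      have "trees_deg U V d e = {}"
      proof (rule ccontr)
        assume "trees_deg U V d e \<noteq> {}"
        then obtain E where E: "E \<in> trees_deg U V d e" by blast
        then have b: "btree U V E" by (simp add: trees_deg_def)
        have "card (E `` {u}) > 0" if "u \<in> U" for u
          using btree_Domain[OF b] that btree_finite_edges[OF b] by (auto simp: card_gt_0_iff finite_Image)
        then have "d u > 0" if "u \<in> U" for u using E that by (auto simp: trees_deg_def)
        moreover have "sum d U = card E"
          using sum_card_Image[OF fin(1) btree_finite_edges[OF b] btree_subset[OF b]] E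
          by (simp add: trees_deg_def)
        moreover have "card E < 2 * card U" using btree_card[OF b] le by simp
        ultimately show False using ex_eq_1_of_sum[of U d] False by auto
      qed
      moreover have "words_deg (card V - 1) U d = {}"
      proof (rule ccontr)
        assume "words_deg (card V - 1) U d \<noteq> {}"
        then obtain xs where xs: "xs \<in> words_deg (card V - 1) U d" by blast
        then have "sum d U = (\<Sum>u\<in>U. Suc (count_list xs u))" by (simp add: words_deg_def)
        also have "\<dots> = card U + (\<Sum>u\<in>U. count_list xs u)" by (simp add: sum_Suc)
        also have "(\<Sum>u\<in>U. count_list xs u) = card V - 1"
          using xs sum_count_set[of xs U] fin by (simp add: words_deg_def)
        finally have "sum d U < 2 * card U" using le \<open>card U \<ge> 2\<close> by linarith
        moreover have "d u > 0" if "u \<in> U" for u using xs that by (auto simp: words_deg_def)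
        ultimately show False using ex_eq_1_of_sum[of U d] False by auto
      qed
      ultimately show ?thesis by simp
    qed
  qed
  show ?case
  proof (cases "card V \<le> card U")
    case True
    show ?thesis by (rule main) (use less True in auto)
  next
    case False
    \<comment> \<open>Passing to converse relations exchanges the classes, so the larger one may be
      taken on the left.\<close>
    have "card (trees_deg V U e d) =
      card (words_deg (card U - 1) V e) * card (words_deg (card V - 1) U d)"
      by (rule main) (use less False in \<open>auto simp: add.commute\<close>)
    then show ?thesis by (simp add: card_trees_deg_swap[of U V] mult.commute)
  qed
qed

subsection \<open>Words with even letter counts\<close>

definition even_words :: "nat \<Rightarrow> 'a set \<Rightarrow> 'a list set" where
  "even_words n U = {xs. length xs = n \<and> set xs \<subseteq> U \<and> (\<forall>u\<in>U. even (count_list xs u))}"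

text \<open>Both sets are partitioned by the values of \<open>f\<close> and \<open>g\<close>, and
  \<open>P\<close> selects whole fibres. This carries the count for fixed degrees over to the parity
  condition.\<close>

lemma card_Collect_eq_if_fibres_eq:
  assumes "finite A" "finite B"
    and "\<And>k. card {a \<in> A. f a = k} = card {b \<in> B. g b = k}"
  shows "card {a \<in> A. P (f a)} = card {b \<in> B. P (g b)}"
proof -
  define K where "K = {k \<in> f ` A \<union> g ` B. P k}"
  have K: "finite K" using assms by (simp add: K_def)
  have "card {a \<in> A. P (f a)} = card (\<Union>k\<in>K. {a \<in> A. f a = k})"
    by (rule arg_cong[of _ _ card]) (auto simp: K_def)
  also have "\<dots> = (\<Sum>k\<in>K. card {a \<in> A. f a = k})"
    using assms K by (intro card_UN_disjoint) auto
  also have "\<dots> = (\<Sum>k\<in>K. card {b \<in> B. g b = k})" by (simp add: assms(3))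
  also have "\<dots> = card (\<Union>k\<in>K. {b \<in> B. g b = k})"
    using assms K by (intro card_UN_disjoint[symmetric]) auto
  also have "\<dots> = card {b \<in> B. P (g b)}"
    by (rule arg_cong[of _ _ card]) (auto simp: K_def)
  finally show ?thesis .
qed

definition odd_btrees :: "'a set \<Rightarrow> 'b set \<Rightarrow> ('a \<times> 'b) set set" where
  "odd_btrees U V = {E. btree U V E \<and> (\<forall>u\<in>U. odd (card (E `` {u}))) \<and> (\<forall>v\<in>V. odd (card (E\<inverse> `` {v})))}"

text \<open>A degree is one more than the matching letter count, so odd degrees correspond to even
  counts.\<close>

lemma card_odd_btrees:
  fixes U V :: "'a set"
  assumes "finite U" "finite V" "U \<noteq> {}" "V \<noteq> {}"
  shows "card (odd_btrees U V) = card (even_words (card V - 1) U) * card (even_words (card U - 1) V)"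
proof -
  define A where "A = {E. btree U V E}"
  define B where "B = {xs. set xs \<subseteq> U \<and> length xs = card V - 1} \<times> {xs. set xs \<subseteq> V \<and> length xs = card U - 1}"
  \<comment> \<open>Values outside \<open>U\<close> and \<open>V\<close> are set to 0, so that
    equality of these functions means exactly equality of degrees on the two classes. A pair
    \<open>k\<close> with another value outside has empty fibres on both sides.\<close>
  define f where "f = (\<lambda>E. (\<lambda>u. if u \<in> U then card (E `` {u}) else 0, \<lambda>v. if v \<in> V then card (E\<inverse> `` {v}) else 0))"
  define g where "g = (\<lambda>(xs, ys). (\<lambda>u. if u \<in> U then Suc (count_list xs u) else 0,
    \<lambda>v. if v \<in> V then Suc (count_list ys v) else 0))"
  have A: "finite A"
    by (rule finite_subset[of _ "Pow (U \<times> V)"]) (auto simp: A_def assms dest: btree_subset)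
  have B: "finite B" using assms by (simp add: B_def finite_lists_length_eq)
  have "card {E \<in> A. f E = k} = card {w \<in> B. g w = k}" for k
  proof (cases k)
    case (Pair d e)
    show ?thesis
    proof (cases "(\<forall>u. u \<notin> U \<longrightarrow> d u = 0) \<and> (\<forall>v. v \<notin> V \<longrightarrow> e v = 0)")
      case True
      have "{E \<in> A. f E = k} = trees_deg U V d e"
        using True by (auto simp: A_def f_def Pair trees_deg_def fun_eq_iff)
      moreover have "{w \<in> B. g w = k} = words_deg (card V - 1) U d \<times> words_deg (card U - 1) V e"
        using True by (auto simp: B_def g_def Pair words_deg_def fun_eq_iff)
      ultimately show ?thesis using card_trees_deg[OF assms] by (simp add: card_cartesian_product)
    next
      case False
      then have "f E \<noteq> k" "g w \<noteq> k" for E w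
        by (auto simp: f_def g_def Pair fun_eq_iff split: prod.splits)
      then show ?thesis by simp
    qed
  qed
  from card_Collect_eq_if_fibres_eq[OF A B this, where P = "\<lambda>(d, e). (\<forall>u\<in>U. odd (d u)) \<and> (\<forall>v\<in>V. odd (e v))"]
  have "card {E \<in> A. case f E of (d, e) \<Rightarrow> (\<forall>u\<in>U. odd (d u)) \<and> (\<forall>v\<in>V. odd (e v))} =
    card {w \<in> B. case g w of (d, e) \<Rightarrow> (\<forall>u\<in>U. odd (d u)) \<and> (\<forall>v\<in>V. odd (e v))}" .
  also have "{E \<in> A. case f E of (d, e) \<Rightarrow> (\<forall>u\<in>U. odd (d u)) \<and> (\<forall>v\<in>V. odd (e v))} = odd_btrees U V"
    by (auto simp: A_def f_def odd_btrees_def)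
  also have "{w \<in> B. case g w of (d, e) \<Rightarrow> (\<forall>u\<in>U. odd (d u)) \<and> (\<forall>v\<in>V. odd (e v))} =
      even_words (card V - 1) U \<times> even_words (card U - 1) V"
    by (auto simp: B_def g_def even_words_def)
  finally show ?thesis by (simp add: card_cartesian_product)
qed

section \<open>Counting even words by sign vectors\<close>

lemma sum_power_eq_sum_words:
  fixes w :: "'a \<Rightarrow> 'b::comm_semiring_1"
  assumes "finite U"
  shows "sum w U ^ n = (\<Sum>xs | set xs \<subseteq> U \<and> length xs = n. prod_list (map w xs))"
proof (induction n)
  case 0
  have "{xs. set xs \<subseteq> U \<and> xs = []} = {[]}" by auto
  then show ?case by simp
next
  case (Suc n)
  let ?L = "\<lambda>n. {xs. set xs \<subseteq> U \<and> length xs = n}"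
  have L: "?L (Suc n) = (\<lambda>(x, xs). x # xs) ` (U \<times> ?L n)"
    by (auto simp: length_Suc_conv image_iff)
  have "(\<Sum>xs\<in>?L (Suc n). prod_list (map w xs)) = (\<Sum>(x, xs)\<in>U \<times> ?L n. w x * prod_list (map w xs))"
    unfolding L by (subst sum.reindex) (auto simp: inj_on_def case_prod_unfold)
  also have "\<dots> = sum w U * (\<Sum>xs\<in>?L n. prod_list (map w xs))"
    by (simp add: sum.cartesian_product[symmetric] sum_product)
  finally show ?case using Suc by simp
qed

lemma prod_list_map_eq_prod_count:
  fixes w :: "'a \<Rightarrow> 'b::comm_monoid_mult"
  assumes "finite U" "set xs \<subseteq> U"
  shows "prod_list (map w xs) = (\<Prod>u\<in>U. w u ^ count_list xs u)"
  using assms(2)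
proof (induction xs)
  case (Cons x xs)
  have "(\<Prod>u\<in>U. w u ^ count_list (x # xs) u) = (\<Prod>u\<in>U. (if u = x then w u else 1) * w u ^ count_list xs u)"
    by (intro prod.cong) auto
  also have "\<dots> = w x * (\<Prod>u\<in>U. w u ^ count_list xs u)"
    using Cons.prems assms(1) by (simp add: prod.distrib)
  finally show ?case using Cons by simp
qed simp

lemma sum_Pow_card:
  fixes h :: "nat \<Rightarrow> real"
  assumes "finite U"
  shows "(\<Sum>S\<in>Pow U. h (card S)) = (\<Sum>i = 0..card U. real (card U choose i) * h i)"
proof -
  have "(\<Sum>S\<in>Pow U. h (card S)) = (\<Sum>i = 0..card U. \<Sum>S\<in>{S \<in> Pow U. card S = i}. h (card S))"
    using assms by (intro sum.group[symmetric]) (auto intro: card_mono)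
  also have "\<dots> = (\<Sum>i = 0..card U. real (card U choose i) * h i)"
    using n_subsets[OF assms] by (intro sum.cong) (auto simp: Pow_def)
  finally show ?thesis .
qed

text \<open>A sign vector with \<open>i\<close> plus signs has coordinate sum
  \<open>2 * i - card U\<close>, which explains the right side. Expanding the \<open>n\<close>-th
  powers into words and summing over all sign vectors first, each even word contributes
  \<open>2 ^ card U\<close> and every other word cancels.\<close>

lemma card_even_words:
  assumes "finite U"
  shows "2 ^ card U * real (card (even_words n U)) =
    (\<Sum>i = 0..card U. real (card U choose i) * (2 * real i - real (card U)) ^ n)"
proof -
  \<comment> \<open>The set \<open>S\<close> encodes the sign vector that is 1 exactly on
    \<open>S\<close>.\<close>
  define s :: "'a set \<Rightarrow> 'a \<Rightarrow> real" where "s S u = (if u \<in> S then 1 else - 1)" for S u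
  let ?L = "{xs. set xs \<subseteq> U \<and> length xs = n}"
  have L: "finite ?L" using assms by (rule finite_lists_length_eq)
  have s_sum: "sum (s S) U = 2 * real (card S) - real (card U)" if "S \<subseteq> U" for S
  proof -
    have "sum (s S) U = (\<Sum>u\<in>U. 2 * of_bool (u \<in> S) - 1)" by (intro sum.cong) (auto simp: s_def)
    also have "\<dots> = 2 * real (card (U \<inter> S)) - real (card U)"
      using assms by (simp add: sum_subtractf sum_distrib_left[symmetric])
    finally show ?thesis using that by (simp add: Int_absorb1)
  qed
  have sgn_sum: "(\<Sum>S\<in>Pow U. prod_list (map (s S) xs)) = 2 ^ card U * of_bool (xs \<in> even_words n U)"
    if "xs \<in> ?L" for xs
  proof -
    have "(\<Sum>S\<in>Pow U. prod_list (map (s S) xs)) = (\<Sum>S\<in>Pow U. \<Prod>u\<in>U. s S u ^ count_list xs u)"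
      using that assms by (simp add: prod_list_map_eq_prod_count)
    \<comment> \<open>The signs on \<open>S\<close> contribute only factors 1. Written this way, the
      sum over \<open>S\<close> is the expansion of a product of binomials.\<close>
    also have "\<dots> = (\<Sum>S\<in>Pow U. (\<Prod>u\<in>S. 1) * (\<Prod>u\<in>U - S. (- 1) ^ count_list xs u))"
    proof (intro sum.cong refl)
      fix S assume "S \<in> Pow U"
      then have "(\<Prod>u\<in>U. s S u ^ count_list xs u) =
          (\<Prod>u\<in>U - S. s S u ^ count_list xs u) * (\<Prod>u\<in>S. s S u ^ count_list xs u)"
        using assms by (intro prod.subset_diff) auto
      then show "(\<Prod>u\<in>U. s S u ^ count_list xs u) = (\<Prod>u\<in>S. 1) * (\<Prod>u\<in>U - S. (- 1) ^ count_list xs u)"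
        by (simp add: s_def)
    qed
    also have "\<dots> = (\<Prod>u\<in>U. 1 + (- 1) ^ count_list xs u)"
      using assms by (simp add: prod_add)
    \<comment> \<open>Each factor is 2 for an even count and 0 for an odd one, so a single odd count
      annihilates the product.\<close>
    also have "\<dots> = 2 ^ card U * of_bool (xs \<in> even_words n U)"
    proof (cases "\<forall>u\<in>U. even (count_list xs u)")
      case True
      then show ?thesis using that by (simp add: even_words_def)
    next
      case False
      then obtain u where "u \<in> U" "odd (count_list xs u)" by blast
      then have "(\<Prod>u\<in>U. 1 + (- 1) ^ count_list xs u) = (0 :: real)"
        using assms by (intro prod_zero) (auto intro!: bexI[of _ u])
      then show ?thesis using False by (auto simp: even_words_def)
    qed
    finally show ?thesis .
  qed
  have "(\<Sum>i = 0..card U. real (card U choose i) * (2 * real i - real (card U)) ^ n) =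
      (\<Sum>S\<in>Pow U. (2 * real (card S) - real (card U)) ^ n)"
    by (rule sum_Pow_card[OF assms, symmetric])
  also have "\<dots> = (\<Sum>S\<in>Pow U. sum (s S) U ^ n)"
    by (intro sum.cong) (auto simp: s_sum)
  also have "\<dots> = (\<Sum>xs\<in>?L. \<Sum>S\<in>Pow U. prod_list (map (s S) xs))"
    unfolding sum_power_eq_sum_words[OF assms] by (rule sum.swap)
  also have "\<dots> = (\<Sum>xs\<in>?L. 2 ^ card U * of_bool (xs \<in> even_words n U))"
    using sgn_sum by (intro sum.cong) auto
  also have "\<dots> = 2 ^ card U * real (card (?L \<inter> even_words n U))"
    using L by (simp add: sum_distrib_left[symmetric])
  also have "?L \<inter> even_words n U = even_words n U" by (auto simp: even_words_def)
  finally show ?thesis by simp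
qed

subsection \<open>Odd spanning trees of the complete bipartite graph\<close>

lemma btree_connected:
  assumes "btree U V E" "x \<in> U \<union> V" "y \<in> U \<union> V"
  shows "(x, y) \<in> (E \<union> E\<inverse>)\<^sup>*"
proof -
  \<comment> \<open>This serves as the induction step for both leaf rules: the new vertex
    \<open>u\<close> reaches all of \<open>W\<close>, and is reached from it, through its neighbour
    \<open>v\<close>.\<close>
  have grow: "\<forall>x\<in>insert u W. \<forall>y\<in>insert u W. (x, y) \<in> R'\<^sup>*"
    if "\<forall>x\<in>W. \<forall>y\<in>W. (x, y) \<in> R\<^sup>*" "v \<in> W" "R \<subseteq> R'" "(u, v) \<in> R'" "(v, u) \<in> R'"
    for W u v and R R' :: "('a \<times> 'a) set"
  proof -
    have R: "(x, y) \<in> R'\<^sup>*" if "x \<in> W" "y \<in> W" for x y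
      using that \<open>\<forall>x\<in>W. \<forall>y\<in>W. (x, y) \<in> R\<^sup>*\<close> rtrancl_mono[OF \<open>R \<subseteq> R'\<close>] by blast
    have "(u, y) \<in> R'\<^sup>*" "(y, u) \<in> R'\<^sup>*" if "y \<in> W" for y
      using R[OF \<open>v \<in> W\<close> that] R[OF that \<open>v \<in> W\<close>] \<open>(u, v) \<in> R'\<close> \<open>(v, u) \<in> R'\<close>
      by (auto intro: converse_rtrancl_into_rtrancl rtrancl_into_rtrancl)
    with R show ?thesis by auto
  qed
  have "\<forall>x\<in>U \<union> V. \<forall>y\<in>U \<union> V. (x, y) \<in> (E \<union> E\<inverse>)\<^sup>*"
    using assms(1)
  proof (induction rule: btree.induct)
    case (edge u v)
    show ?case by auto
  next
    case (leaf_left U V E u v)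
    have "\<forall>x\<in>insert u (U \<union> V). \<forall>y\<in>insert u (U \<union> V).
        (x, y) \<in> (insert (u, v) E \<union> (insert (u, v) E)\<inverse>)\<^sup>*"
      by (rule grow[OF leaf_left.IH, of v]) (use leaf_left.hyps in auto)
    then show ?case by simp
  next
    case (leaf_right U V E u v)
    have "\<forall>x\<in>insert v (U \<union> V). \<forall>y\<in>insert v (U \<union> V).
        (x, y) \<in> (insert (u, v) E \<union> (insert (u, v) E)\<inverse>)\<^sup>*"
      by (rule grow[OF leaf_right.IH, of u]) (use leaf_right.hyps in auto)
    then show ?case by simp
  qed
  with assms(2,3) show ?thesis by blast
qed

text \<open>Indices are read modulo \<open>k\<close>, which makes predecessor and successor on the
  cycle explicit. The bound 3 excludes going back and forth along one edge, as in
  \<open>graph_cycle\<close>.\<close>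

definition has_cycle :: "('a \<times> 'a) set \<Rightarrow> bool" where
  "has_cycle R \<longleftrightarrow> (\<exists>f k. 3 \<le> k \<and> inj_on f {..<k} \<and> (\<forall>i<k. (f i, f (Suc i mod k)) \<in> R))"

text \<open>A vertex on a cycle of length at least 3 has two distinct neighbours there, but the only
  neighbour of \<open>u\<close> is \<open>v\<close>. Hence the cycle avoids \<open>u\<close> and
  uses arcs of \<open>R\<close> only.\<close>

lemma has_cycle_insert_leaf:
  assumes "has_cycle (R \<union> {(u, v), (v, u)})" "u \<notin> Field R" "u \<noteq> v"
  shows "has_cycle R"
proof -
  obtain f and k :: nat where k: "3 \<le> k" and inj: "inj_on f {..<k}"
    and arc: "\<And>i. i < k \<Longrightarrow> (f i, f (Suc i mod k)) \<in> R \<union> {(u, v), (v, u)}"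
    using assms(1) unfolding has_cycle_def by blast
  have "f i \<noteq> u" if "i < k" for i
  proof
    assume fi: "f i = u"
    \<comment> \<open>\<open>l\<close> is the cyclic predecessor of \<open>i\<close>; it differs
      from the successor because \<open>k\<close> is at least 3.\<close>
    define l where "l = (if i = 0 then k - 1 else i - 1)"
    have l: "l < k" "Suc l mod k = i" "l \<noteq> Suc i mod k" "Suc i mod k < k"
      using that k by (auto simp: l_def mod_Suc)
    have "f (Suc i mod k) = v" using arc[OF that] fi assms(2,3) by (auto simp: Field_def)
    moreover have "f l = v" using arc[OF l(1)] l(2) fi assms(2,3) by (auto simp: Field_def)
    ultimately show False using inj l by (auto dest: inj_onD)
  qed
  then have "(f i, f (Suc i mod k)) \<in> R" if "i < k" for i
    using arc[OF that] that k by auto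
  with k inj show ?thesis unfolding has_cycle_def by blast
qed

text \<open>Disjointness makes each attached leaf new to both classes, hence absent from all earlier
  edges, as \<open>has_cycle_insert_leaf\<close> demands.\<close>

lemma btree_acyclic:
  assumes "btree U V E" "U \<inter> V = {}"
  shows "\<not> has_cycle (E \<union> E\<inverse>)"
  using assms
proof (induction rule: btree.induct)
  case (edge u v)
  have "\<not> has_cycle ({} :: ('a \<times> 'a) set)" by (auto simp: has_cycle_def intro!: exI[of _ 0])
  then have "\<not> has_cycle ({} \<union> {(u, v), (v, u)})"
    using has_cycle_insert_leaf[of "{}" u v] edge by auto
  moreover have "{(u, v)} \<union> {(u, v)}\<inverse> = {} \<union> {(u, v), (v, u)}" by auto
  ultimately show ?case by simp
next
  case (leaf_left U V E u v)
  have "insert (u, v) E \<union> (insert (u, v) E)\<inverse> = (E \<union> E\<inverse>) \<union> {(u, v), (v, u)}" by auto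
  moreover have "u \<notin> Field (E \<union> E\<inverse>)" "u \<noteq> v"
    using btree_subset[OF leaf_left.hyps(1)] leaf_left by (auto simp: Field_def)
  ultimately show ?case using has_cycle_insert_leaf leaf_left by fastforce
next
  case (leaf_right U V E u v)
  have "insert (u, v) E \<union> (insert (u, v) E)\<inverse> = (E \<union> E\<inverse>) \<union> {(v, u), (u, v)}" by auto
  moreover have "v \<notin> Field (E \<union> E\<inverse>)" "v \<noteq> u"
    using btree_subset[OF leaf_right.hyps(1)] leaf_right by (auto simp: Field_def)
  ultimately show ?case using has_cycle_insert_leaf leaf_right by fastforce
qed

section \<open>Agreement of \<open>btree\<close> and \<open>graph_tree\<close>\<close>

lemma (in wf_digraph) has_cycle_of_graph_cycle:
  assumes "graph_cycle G p"
  shows "has_cycle (arcs_ends G)"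
proof -
  obtain u where p: "awalk u p u" "distinct (tl (awalk_verts u p))" "3 \<le> length p"
    using assms by (auto simp: graph_cycle_def cycle_def)
  then have ne: "p \<noteq> []" by auto
  have cas: "cas u p u" using p(1) by auto
  have hd: "tail G (hd p) = u" using cas ne by (cases p) auto
  have last: "head G (last p) = u" using awlast_if_cas[OF cas] ne by (simp add: awalk_verts_conv)
  \<comment> \<open>The vertices of the closed walk are listed in two ways. Cancelling
    \<open>u\<close> shows that tails and heads agree as multisets, so the tails are distinct too;
    comparing entries identifies each head with the next tail.\<close>
  have eq: "map (tail G) p @ [u] = u # map (head G) p"
    using awalk_verts_conv[of u p] awalk_verts_conv'[OF cas] ne hd last by simp
  have "distinct (map (head G) p)" using p(2) awalk_verts_conv'[OF cas] ne by simp
  moreover have "mset (map (tail G) p) = mset (map (head G) p)"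
    using arg_cong[OF eq, of mset] by simp
  ultimately have "distinct (map (tail G) p)" using mset_eq_imp_distinct_iff by blast
  then have inj: "inj_on (\<lambda>i. tail G (p ! i)) {..<length p}"
    by (auto simp: inj_on_def distinct_conv_nth)
  have "head G (p ! i) = tail G (p ! (Suc i mod length p))" if "i < length p" for i
  proof (cases "Suc i = length p")
    case True
    then have "p ! i = last p" by (metis diff_Suc_1 last_conv_nth ne)
    then show ?thesis using True last hd ne by (simp add: hd_conv_nth)
  next
    case False
    then show ?thesis using arg_cong[OF eq, of "\<lambda>xs. xs ! Suc i"] that by (simp add: nth_append)
  qed
  then have "(tail G (p ! i), tail G (p ! (Suc i mod length p))) \<in> arcs_ends G" if "i < length p" for i
    using that p(1) by (metis awalkE' in_arcs_imp_in_arcs_ends nth_mem subsetD)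
  with inj p(3) show ?thesis unfolding has_cycle_def by blast
qed

lemma graph_tree_of_btree:
  assumes "graph T" "btree U V E" "U \<inter> V = {}" "verts T = U \<union> V" "arcs_ends T = E \<union> E\<inverse>"
  shows "graph_tree T"
proof -
  interpret graph T by fact
  have "connected T"
  proof (rule connectedI)
    show "verts T \<noteq> {}" using assms(2,4) by (auto elim: btree.cases)
    fix u v assume "u \<in> verts T" "v \<in> verts T"
    then have "u \<rightarrow>\<^sup>*\<^bsub>T\<^esub> v"
      using btree_connected[OF assms(2)] assms(4,5) by (simp add: reachable_conv)
    then show "u \<rightarrow>\<^sup>*\<^bsub>mk_symmetric T\<^esub> v" using sym_arcs by (simp add: reachable_mk_symmetric_eq)
  qed
  moreover have "\<not> graph_cycle T p" for p
    using has_cycle_of_graph_cycle[of p] btree_acyclic[OF assms(2,3)] assms(5) by auto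
  ultimately show ?thesis using assms(1) by (simp add: graph_tree_def)
qed

lemma (in wf_digraph) graph_cycle_of_chord:
  assumes "apath y p x" "e \<in> arcs G" "tail G e = x" "head G e = y" "2 \<le> length p"
  shows "graph_cycle G (e # p)"
  using assms by (auto simp: graph_cycle_def cycle_def apath_def awalk_Cons_iff intro!: exI[of _ x])

text \<open>
  A maximal \<^const>\<open>btree\<close> inside a tree spans it by connectedness, and a further edge would
  close a cycle.
\<close>

lemma btree_of_graph_tree:
  assumes "graph_tree T" "U \<inter> V = {}" "U \<noteq> {}" "V \<noteq> {}" "verts T = U \<union> V"
    and "arcs_ends T = E \<union> E\<inverse>" "E \<subseteq> U \<times> V"
  shows "btree U V E"
proof -
  interpret graph T using assms(1) by (simp add: graph_tree_def)
  have sc: "strongly_connected T"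
    using assms(1) sym_arcs by (intro symmetric_connected_imp_strongly_connected) (auto simp: graph_tree_def)
  have "finite U" "finite V" using finite_verts assms(5) by auto
  then have finE: "finite E" using assms(7) by (meson finite_SigmaI finite_subset)
  \<comment> \<open>Each subtree is given by its edges, with \<open>Domain\<close> and
    \<open>Range\<close> as its vertex classes.\<close>
  define S where "S = {F. F \<subseteq> E \<and> btree (Domain F) (Range F) F}"
  have finS: "finite S" unfolding S_def using finE by auto
  have "E \<noteq> {}"
  proof
    assume "E = {}"
    obtain u v where "u \<in> U" "v \<in> V" using assms by auto
    then have "u \<rightarrow>\<^sup>*\<^bsub>T\<^esub> v" using sc assms(5) by auto
    then have "u = v" using \<open>E = {}\<close> assms(6) by (simp add: reachable_conv)
    then show False using \<open>u \<in> U\<close> \<open>v \<in> V\<close> assms(2) by auto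
  qed
  then obtain u v where "(u, v) \<in> E" by auto
  then have "{(u, v)} \<in> S" by (auto simp: S_def intro: btree.edge)
  then have "S \<noteq> {}" by blast
  then obtain F where F: "F \<in> S" and max: "\<And>F'. F' \<in> S \<Longrightarrow> card F' \<le> card F"
    using finS by (metis obtains_MAX Max_ge finite_imageI imageI)
  have sub: "F \<subseteq> E" and bF: "btree (Domain F) (Range F) F" using F by (auto simp: S_def)
  have no_ext: "insert (x, y) F \<notin> S" if "(x, y) \<notin> F" for x y
    using max[of "insert (x, y) F"] that finite_subset[OF sub finE] by auto
  \<comment> \<open>An edge with exactly one end in \<open>F\<close> could be attached as a leaf,
    contradicting the maximality of \<open>F\<close>.\<close>
  have ext: "x \<in> Domain F \<longleftrightarrow> y \<in> Range F" if "(x, y) \<in> E" for x y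
  proof (rule ccontr)
    assume neq: "\<not> ?thesis"
    then have "(x, y) \<notin> F" by auto
    have "btree (Domain (insert (x, y) F)) (Range (insert (x, y) F)) (insert (x, y) F)"
    proof (cases "x \<in> Domain F")
      case True
      then have "insert x (Domain F) = Domain F" by auto
      then show ?thesis using True neq btree.leaf_right[OF bF, of x y] by simp
    next
      case False
      then have "insert y (Range F) = Range F" using neq by auto
      then show ?thesis using False neq btree.leaf_left[OF bF, of x y] by simp
    qed
    then show False using no_ext[OF \<open>(x, y) \<notin> F\<close>] sub that by (auto simp: S_def)
  qed
  have dom: "Domain F \<subseteq> U" and ran: "Range F \<subseteq> V" using sub assms(7) by auto
  obtain r where r: "r \<in> Domain F" using bF by (cases rule: btree.cases) auto
  have reach: "x \<in> Domain F \<union> Range F" if "r \<rightarrow>\<^sup>*\<^bsub>T\<^esub> x" for x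
    using that
  proof (induction rule: reachable_induct)
    case base
    then show ?case using r by simp
  next
    case (step x y)
    then have "(x, y) \<in> E \<or> (y, x) \<in> E" using assms(6) by auto
    then show ?case using step.IH ext[of x y] ext[of y x] dom ran assms(2,7) by blast
  qed
  have "U \<union> V \<subseteq> Domain F \<union> Range F"
  proof
    fix x assume "x \<in> U \<union> V"
    moreover have "r \<in> U \<union> V" using r dom by auto
    ultimately have "r \<rightarrow>\<^sup>*\<^bsub>T\<^esub> x" using sc assms(5) by auto
    then show "x \<in> Domain F \<union> Range F" by (rule reach)
  qed
  then have UV: "Domain F = U" "Range F = V" using dom ran assms(2) by blast+
  have "E \<subseteq> F"
  proof (rule subrelI, rule ccontr)
    fix x y assume xy: "(x, y) \<in> E" "(x, y) \<notin> F"
    \<comment> \<open>\<open>H\<close> keeps only the arcs of the tree \<open>F\<close>, so a path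
      from \<open>y\<close> to \<open>x\<close> in \<open>H\<close> avoids the edge between
      \<open>x\<close> and \<open>y\<close>.\<close>
    define H where "H = \<lparr>verts = verts T, arcs = {a \<in> arcs T. arc_to_ends T a \<in> F \<union> F\<inverse>},
      tail = tail T, head = head T\<rparr>"
    interpret H: wf_digraph H by unfold_locales (auto simp: H_def)
    have subg: "subgraph H T"
      using H.wf_digraph_axioms wf_digraph_axioms by (auto simp: subgraph_def compatible_def H_def)
    have ends: "arcs_ends H = F \<union> F\<inverse>"
    proof -
      have "arcs_ends H = arcs_ends T \<inter> (F \<union> F\<inverse>)"
        by (auto simp: H_def arcs_ends_def arc_to_ends_def)
      then show ?thesis using sub assms(6) by auto
    qed
    have x: "x \<in> U" "y \<in> V" using xy assms(7) by auto
    have "y \<rightarrow>\<^sup>*\<^bsub>H\<^esub> x"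
      using btree_connected[OF bF, of y x] x UV assms(5)
      by (simp add: H.reachable_conv ends) (simp add: H_def)
    then obtain p where p: "H.apath y p x" by (auto simp: H.reachable_apath)
    have "p \<noteq> []" using p x assms(2) by (auto simp: H.apath_Nil_iff)
    moreover have "p \<noteq> [a]" for a
    proof
      assume "p = [a]"
      then have "(y, x) \<in> arcs_ends H"
        using p by (auto simp: H.apath_Cons_iff H.apath_Nil_iff arcs_ends_conv)
      then show False using ends xy sub assms(2,7) x by auto
    qed
    \<comment> \<open>With the arc from \<open>x\<close> to \<open>y\<close> added, the closed walk
      has length at least 3 and so counts as a \<open>graph_cycle\<close>.\<close>
    ultimately have len: "2 \<le> length p" by (cases p rule: remdups_adj.cases) auto
    have "apath y p x" using subg p by (rule subgraph_apath_imp_apath[rotated])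
    moreover have "(x, y) \<in> arcs_ends T" using xy assms(6) by simp
    then obtain e where "e \<in> arcs T" "tail T e = x" "head T e = y" by (rule reachableE)
    ultimately have "graph_cycle T (e # p)" using len by (intro graph_cycle_of_chord)
    then show False using assms(1) by (auto simp: graph_tree_def)
  qed
  with sub bF UV show ?thesis by (metis subset_antisym)
qed

section \<open>Odd spanning trees as subsets of \<open>U \<times> V\<close>\<close>

lemma (in nomulti_digraph) out_degree_eq_card_Image:
  "out_degree G v = card (arcs_ends G `` {v})"
proof -
  have "arcs_ends G `` {v} = head G ` out_arcs G v"
    by (auto simp: arcs_ends_conv image_iff)
  moreover have "inj_on (head G) (out_arcs G v)"
    by (auto simp: inj_on_def arc_to_ends_def intro: no_multi_arcs)
  ultimately show ?thesis by (simp add: out_degree_def card_image)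
qed

lemma tau_o_eq_card_odd_btrees:
  assumes "graph G" "verts G = U \<union> V" "U \<inter> V = {}" "U \<noteq> {}" "V \<noteq> {}"
    and "arcs_ends G = U \<times> V \<union> V \<times> U"
  shows "tau_o G = card (odd_btrees U V)"
proof -
  interpret G: graph G by fact
  \<comment> \<open>\<open>mk\<close> turns an edge set into the spanning subgraph of
    \<open>G\<close> that has both arcs of each edge; it is shown to be a bijection from
    \<open>odd_btrees U V\<close> onto the odd spanning trees.\<close>
  define mk where "mk E = \<lparr>verts = verts G, arcs = {a \<in> arcs G. arc_to_ends G a \<in> E \<union> E\<inverse>},
    tail = tail G, head = head G\<rparr>" for E
  have ends: "arcs_ends (mk E) = E \<union> E\<inverse>" if "E \<subseteq> U \<times> V" for E
  proof -
    have "arcs_ends (mk E) = arcs_ends G \<inter> (E \<union> E\<inverse>)"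
      by (auto simp: mk_def arcs_ends_def arc_to_ends_def)
    then show ?thesis using that assms(6) by auto
  qed
  have graph_mk: "graph (mk E)" if "E \<subseteq> U \<times> V" for E
  proof -
    interpret wf_digraph "mk E" by unfold_locales (auto simp: mk_def)
    show ?thesis
    proof
      show "symmetric (mk E)" unfolding symmetric_def ends[OF that] by (auto simp: sym_def)
      show "e1 = e2" if "e1 \<in> arcs (mk E)" "e2 \<in> arcs (mk E)"
        "arc_to_ends (mk E) e1 = arc_to_ends (mk E) e2" for e1 e2
        using that by (intro G.no_multi_arcs) (auto simp: mk_def arc_to_ends_def)
    qed (auto simp: mk_def G.no_loops)
  qed
  have span_mk: "spanning (mk E) G" if "E \<subseteq> U \<times> V" for E
  proof -
    interpret M: graph "mk E" using graph_mk[OF that] .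
    show ?thesis using G.wf_digraph_axioms M.wf_digraph_axioms
      by (auto simp: spanning_def subgraph_def compatible_def mk_def)
  qed
  have deg: "(\<forall>v\<in>verts (mk E). odd (out_degree (mk E) v)) \<longleftrightarrow>
      (\<forall>u\<in>U. odd (card (E `` {u}))) \<and> (\<forall>v\<in>V. odd (card (E\<inverse> `` {v})))" if "E \<subseteq> U \<times> V" for E
  proof -
    interpret M: graph "mk E" using graph_mk[OF that] .
    have "(E \<union> E\<inverse>) `` {u} = E `` {u}" if "u \<in> U" for u
      using that \<open>E \<subseteq> U \<times> V\<close> assms(3) by auto
    moreover have "(E \<union> E\<inverse>) `` {v} = E\<inverse> `` {v}" if "v \<in> V" for v
      using that \<open>E \<subseteq> U \<times> V\<close> assms(3) by auto
    moreover have "verts (mk E) = U \<union> V" by (simp add: mk_def assms(2))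
    ultimately show ?thesis by (simp add: M.out_degree_eq_card_Image ends[OF that] ball_Un)
  qed
  have "{T. odd_spanning_tree T G} = mk ` odd_btrees U V"
  proof (intro set_eqI iffI)
    fix T assume "T \<in> {T. odd_spanning_tree T G}"
    then have tree: "graph_tree T" and span: "spanning T G"
      and odd: "\<forall>v\<in>verts T. odd (out_degree T v)"
      by (auto simp: odd_spanning_tree_def graph_spanning_tree_def)
    interpret T: graph T using tree by (simp add: graph_tree_def)
    have T: "verts T = verts G" "arcs T \<subseteq> arcs G" "tail T = tail G" "head T = head G"
      using span by (auto simp: spanning_def subgraph_def compatible_def)
    then have ateq: "arc_to_ends T = arc_to_ends G" by (simp add: arc_to_ends_def fun_eq_iff)
    define E where "E = arcs_ends T \<inter> U \<times> V"
    have E: "E \<subseteq> U \<times> V" by (simp add: E_def)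
    have "arcs_ends T \<subseteq> U \<times> V \<union> V \<times> U"
      using T(2) assms(6) unfolding arcs_ends_def ateq by blast
    then have endsT: "arcs_ends T = E \<union> E\<inverse>"
      using T.graph_symmetric unfolding E_def by blast
    \<comment> \<open>\<open>G\<close> has no parallel arcs, so the arcs of \<open>T\<close> are
      determined by their ends, and \<open>T\<close> can be recovered from \<open>E\<close>.\<close>
    have "arcs T = {a \<in> arcs G. arc_to_ends G a \<in> arcs_ends T}"
    proof (intro set_eqI iffI)
      fix a assume "a \<in> {a \<in> arcs G. arc_to_ends G a \<in> arcs_ends T}"
      then obtain b where "b \<in> arcs T" "arc_to_ends G a = arc_to_ends G b" "a \<in> arcs G"
        by (auto simp: arcs_ends_def ateq)
      then show "a \<in> arcs T" using G.no_multi_arcs T(2) by blast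
    qed (use T(2) in \<open>auto simp: arcs_ends_def ateq\<close>)
    then have "T = mk E" using T endsT by (simp add: mk_def)
    moreover have "btree U V E"
      using btree_of_graph_tree[OF tree assms(3-5)] T(1) assms(2) endsT E by simp
    ultimately show "T \<in> mk ` odd_btrees U V"
      using odd deg[OF E] by (auto simp: odd_btrees_def)
  next
    fix T assume "T \<in> mk ` odd_btrees U V"
    then obtain E where T: "T = mk E" and E: "E \<in> odd_btrees U V" by blast
    then have b: "btree U V E" by (simp add: odd_btrees_def)
    note sub = btree_subset[OF b]
    have "graph_tree T"
      unfolding T using graph_mk[OF sub] b assms(3)
      by (rule graph_tree_of_btree) (use ends[OF sub] assms(2) in \<open>auto simp: mk_def\<close>)
    then show "T \<in> {T. odd_spanning_tree T G}"
      using span_mk[OF sub] deg[OF sub] E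
      by (simp add: odd_spanning_tree_def graph_spanning_tree_def T odd_btrees_def)
  qed
  moreover have "inj_on mk (odd_btrees U V)"
  proof (rule inj_onI)
    fix E F assume "E \<in> odd_btrees U V" "F \<in> odd_btrees U V" and eq: "mk E = mk F"
    then have sub: "E \<subseteq> U \<times> V" "F \<subseteq> U \<times> V" by (auto simp: odd_btrees_def dest: btree_subset)
    then have "E \<union> E\<inverse> = F \<union> F\<inverse>" using ends eq by metis
    \<comment> \<open>As the classes are disjoint, each edge set is recovered from its symmetric
      closure by keeping the pairs directed from \<open>U\<close> to \<open>V\<close>.\<close>
    moreover have "(X \<union> X\<inverse>) \<inter> U \<times> V = X" if "X \<subseteq> U \<times> V" for X using that assms(3) by blast
    ultimately show "E = F" using sub by metis
  qed
  ultimately show ?thesis by (simp add: tau_o_def card_image)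
qed

theorem theorem4p1:
  fixes m n :: nat and G :: "('a, 'b) pre_digraph"
  assumes "m > 0" and "n > 0"
    and "complete_bipartite_digraph m n G"
  shows "real (tau_o G) =
    1 / 2 ^ (m + n)
      * (\<Sum>i = 0..m. real (m choose i) * (2 * real i - real m) ^ (n - 1))
      * (\<Sum>j = 0..n. real (n choose j) * (2 * real j - real n) ^ (m - 1))"
proof -
  obtain U V where G: "graph G" "verts G = U \<union> V" "U \<inter> V = {}" "arcs_ends G = U \<times> V \<union> V \<times> U"
    and card: "card U = m" "card V = n"
    using assms(3) unfolding complete_bipartite_digraph_def by blast
  have UV: "finite U" "finite V" "U \<noteq> {}" "V \<noteq> {}"
    using card assms(1,2) by (auto simp: card_gt_0_iff)
  have "tau_o G = card (even_words (n - 1) U) * card (even_words (m - 1) V)"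
    using tau_o_eq_card_odd_btrees[OF G(1-3) UV(3,4) G(4)] card_odd_btrees[OF UV] card by simp
  \<comment> \<open>The power of 2 is split so that each class gets the normalising factor of its
    own sign vectors.\<close>
  then have "2 ^ (m + n) * real (tau_o G) =
      (2 ^ m * real (card (even_words (n - 1) U))) * (2 ^ n * real (card (even_words (m - 1) V)))"
    by (simp add: power_add)
  also have "\<dots> = (\<Sum>i = 0..m. real (m choose i) * (2 * real i - real m) ^ (n - 1))
      * (\<Sum>j = 0..n. real (n choose j) * (2 * real j - real n) ^ (m - 1))"
    using card_even_words[OF UV(1), of "n - 1"] card_even_words[OF UV(2), of "m - 1"] card by simp
  finally show ?thesis by (simp add: field_simps)
qed

end
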